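(* Let $G$ be a DAG on $[n]$ and suppose that $H\cup O=[n]$ is an upstream partition of the vertices of $G$. Then each of the polynomials $\phi_G(\sigma_{ij})$ is homogeneous with respect to the upstream grading, and $$\deg(\sigma_{ij})=\begin{cases}(1,0)&\text{if } i\in H,\ j\in H,\\ (1,1)&\text{if } i\in H, j\in O\ \text{ or }\ i\in O, j\in H,\\ (1,2)&\text{if } i\in O,\ j\in O.\end{cases}$$ Thus, $I_G$ is homogeneous with respect to the induced grading on $\mathbb{C}[\Sigma]$.
   Context: Let $G$ be a directed acyclic graph (DAG) with vertex set $[n]=\{1,\dots,n\}$, numerically ordered: $i\to j\in E(G)$ only if $i<j$. A collider is a pair of edges $i\to k$, $j\to k$ with the same head. For vertices $i,j$, let $T(i,j)$ be the set of treks from $i$ to $j$: simple paths $P$ in (the underlying undirected graph of) $G$ from $i$ to $j$ containing no collider. Each trek goes from $i$ up to a topmost vertex $\mathrm{top}(P)$ and then down to $j$; $T(i,i)$ consists of the single empty trek, with top $i$. Let $\mathbb{C}[\Sigma]=\mathbb{C}[\sigma_{ij}\mid 1\le i\le j\le n]$ and let $\phi_G:\mathbb{C}[\Sigma]\to\mathbb{C}[a,\lambda]=\mathbb{C}[a_i,\lambda_{ij}\mid i\in[n],\ i\to j\in E(G)]$ be the ring homomorphism $\sigma_{ij}\mapsto\sum_{P\in T(i,j)}a_{\mathrm{top}(P)}\prod_{k\to l\in P}\lambda_{kl}$ (so $\sigma_{ii}\mapsto a_i$, and $\sigma_{ij}\mapsto 0$ if $T(i,j)=\emptyset$). Set $I_G=\ker\phi_G$.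 A partition $H\cup O$ of the vertices (hidden and observed nodes) is upstream if there is no edge $o\to h$ in $G$ with $o\in O$ and $h\in H$. The upstream grading on $\mathbb{C}[a,\lambda]$ is the $\mathbb{Z}^2$-grading with $\deg a_h=(1,0)$ for $h\in H$, $\deg a_o=(1,2)$ for $o\in O$, $\deg\lambda_{ho}=(0,1)$ if $h\in H$ and $o\in O$, and $\deg\lambda_{ij}=(0,0)$ otherwise. The displayed $\deg(\sigma_{ij})$ is the degree of $\phi_G(\sigma_{ij})$ (when nonzero), and it defines the induced grading on $\mathbb{C}[\Sigma]$. *)

theory Defs
  imports Complex_Main "HOL-Library.Poly_Mapping"
begin

section \<open>Complex polynomials\<close>

text \<open>Finitely supported maps from exponent vectors to coefficients, with the convolution
  product of \<^theory>\<open>HOL-Library.Poly_Mapping\<close>; \<open>'v\<close> is the type of variable names.\<close>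

type_synonym 'v cpoly = "('v \<Rightarrow>\<^sub>0 nat) \<Rightarrow>\<^sub>0 complex"

definition Const :: "complex \<Rightarrow> 'v cpoly" where
  "Const c = Poly_Mapping.single 0 c"

definition Var :: "'v \<Rightarrow> 'v cpoly" where
  "Var v = Poly_Mapping.single (Poly_Mapping.single v 1) 1"

definition poly_over :: "'v set \<Rightarrow> 'v cpoly set" where
  "poly_over V = {f. \<forall>m \<in> Poly_Mapping.keys f. Poly_Mapping.keys m \<subseteq> V}"

text \<open>The homomorphism of complex algebras sending each variable \<open>v\<close> to \<open>s v\<close>; the lemmas
  \<open>poly_subst_Const\<close>, \<open>poly_subst_Var\<close>, \<open>poly_subst_add\<close> and \<open>poly_subst_mult\<close>
  below confirm this.\<close>

definition poly_subst :: "('v \<Rightarrow> 'w cpoly) \<Rightarrow> 'v cpoly \<Rightarrow> 'w cpoly" where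
  "poly_subst s f =
     (\<Sum>m \<in> Poly_Mapping.keys f. Const (Poly_Mapping.lookup f m) *
        (\<Prod>v \<in> Poly_Mapping.keys m. s v ^ Poly_Mapping.lookup m v))"

definition poly_ideal :: "'v set \<Rightarrow> 'v cpoly set \<Rightarrow> bool" where
  "poly_ideal V I \<longleftrightarrow> I \<subseteq> poly_over V \<and> 0 \<in> I \<and>
     (\<forall>f\<in>I. \<forall>g\<in>I. f + g \<in> I) \<and> (\<forall>r \<in> poly_over V. \<forall>f\<in>I. r * f \<in> I)"


subsection \<open>Gradings by \<open>\<int>\<^sup>2\<close> given by degrees of the variables\<close>

definition mono_deg :: "('v \<Rightarrow> int \<times> int) \<Rightarrow> ('v \<Rightarrow>\<^sub>0 nat) \<Rightarrow> int \<times> int" where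
  "mono_deg w m =
     (\<Sum>v \<in> Poly_Mapping.keys m. int (Poly_Mapping.lookup m v) * fst (w v),
      \<Sum>v \<in> Poly_Mapping.keys m. int (Poly_Mapping.lookup m v) * snd (w v))"

definition homogeneous_of_degree :: "('v \<Rightarrow> int \<times> int) \<Rightarrow> int \<times> int \<Rightarrow> 'v cpoly \<Rightarrow> bool" where
  "homogeneous_of_degree w d f \<longleftrightarrow> (\<forall>m \<in> Poly_Mapping.keys f. mono_deg w m = d)"

definition homogeneous :: "('v \<Rightarrow> int \<times> int) \<Rightarrow> 'v cpoly \<Rightarrow> bool" where
  "homogeneous w f \<longleftrightarrow> (\<exists>d. homogeneous_of_degree w d f)"

text \<open>Meaningful only for nonzero homogeneous \<open>f\<close>: the zero polynomial is homogeneous of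
  every degree.\<close>

definition hdeg :: "('v \<Rightarrow> int \<times> int) \<Rightarrow> 'v cpoly \<Rightarrow> int \<times> int" where
  "hdeg w f = (THE d. homogeneous_of_degree w d f)"

definition hcomponent :: "('v \<Rightarrow> int \<times> int) \<Rightarrow> int \<times> int \<Rightarrow> 'v cpoly \<Rightarrow> 'v cpoly" where
  "hcomponent w d f =
     (\<Sum>m \<in> {m \<in> Poly_Mapping.keys f. mono_deg w m = d}.
        Poly_Mapping.single m (Poly_Mapping.lookup f m))"

definition homogeneous_ideal :: "'v set \<Rightarrow> ('v \<Rightarrow> int \<times> int) \<Rightarrow> 'v cpoly set \<Rightarrow> bool" where
  "homogeneous_ideal V w I \<longleftrightarrow>
     poly_ideal V I \<and> (\<forall>f\<in>I. \<forall>d. hcomponent w d f \<in> I)"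


section \<open>Directed acyclic graphs and treks\<close>

definition ordered_dag :: "nat \<Rightarrow> (nat \<times> nat) set \<Rightarrow> bool" where
  "ordered_dag n E \<longleftrightarrow> E \<subseteq> {1..n} \<times> {1..n} \<and> acyclic E \<and> (\<forall>(i, j) \<in> E. i < j)"

text \<open>A path in the underlying undirected graph is given by its list of vertices; these are
  the edges of the digraph it uses, with their orientation in the digraph.\<close>

definition path_edges :: "(nat \<times> nat) set \<Rightarrow> nat list \<Rightarrow> (nat \<times> nat) set" where
  "path_edges E p =
     {(k, l) \<in> E. \<exists>m. Suc m < length p \<and> {p ! m, p ! Suc m} = {k, l}}"

definition simple_path :: "nat \<Rightarrow> (nat \<times> nat) set \<Rightarrow> nat \<Rightarrow> nat \<Rightarrow> nat list \<Rightarrow> bool" where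
  "simple_path n E i j p \<longleftrightarrow>
     p \<noteq> [] \<and> hd p = i \<and> last p = j \<and> distinct p \<and> set p \<subseteq> {1..n} \<and>
     (\<forall>m. Suc m < length p \<longrightarrow> (p ! m, p ! Suc m) \<in> E \<or> (p ! Suc m, p ! m) \<in> E)"

definition has_collider :: "(nat \<times> nat) set \<Rightarrow> bool" where
  "has_collider F \<longleftrightarrow> (\<exists>i j k. i \<noteq> j \<and> (i, k) \<in> F \<and> (j, k) \<in> F)"

definition treks :: "nat \<Rightarrow> (nat \<times> nat) set \<Rightarrow> nat \<Rightarrow> nat \<Rightarrow> nat list set" where
  "treks n E i j = {p. simple_path n E i j p \<and> \<not> has_collider (path_edges E p)}"

text \<open>The topmost vertex of a trek is its only vertex that no edge of the trek enters.\<close>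

definition trek_top :: "(nat \<times> nat) set \<Rightarrow> nat list \<Rightarrow> nat" where
  "trek_top E p = (THE v. v \<in> set p \<and> (\<forall>u. (u, v) \<notin> path_edges E p))"


section \<open>The trek parametrization and its vanishing ideal\<close>

datatype param = A nat | Lam nat nat

definition sigma_vars :: "nat \<Rightarrow> (nat \<times> nat) set" where
  "sigma_vars n = {(i, j). 1 \<le> i \<and> i \<le> j \<and> j \<le> n}"

definition sigma :: "nat \<Rightarrow> nat \<Rightarrow> (nat \<times> nat) cpoly" where
  "sigma i j = Var (min i j, max i j)"

definition trek_sum :: "nat \<Rightarrow> (nat \<times> nat) set \<Rightarrow> nat \<Rightarrow> nat \<Rightarrow> param cpoly" where
  "trek_sum n E i j =
     (\<Sum>p \<in> treks n E i j. Var (A (trek_top E p)) * (\<Prod>(k, l) \<in> path_edges E p. Var (Lam k l)))"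

definition phi :: "nat \<Rightarrow> (nat \<times> nat) set \<Rightarrow> (nat \<times> nat) cpoly \<Rightarrow> param cpoly" where
  "phi n E = poly_subst (\<lambda>(i, j). trek_sum n E i j)"

definition I_G :: "nat \<Rightarrow> (nat \<times> nat) set \<Rightarrow> (nat \<times> nat) cpoly set" where
  "I_G n E = {f \<in> poly_over (sigma_vars n). phi n E f = 0}"


section \<open>Upstream partitions and gradings\<close>

definition upstream_partition ::
  "nat \<Rightarrow> (nat \<times> nat) set \<Rightarrow> nat set \<Rightarrow> nat set \<Rightarrow> bool" where
  "upstream_partition n E H Ob \<longleftrightarrow>
     H \<union> Ob = {1..n} \<and> H \<inter> Ob = {} \<and> (\<forall>u \<in> Ob. \<forall>h \<in> H. (u, h) \<notin> E)"

fun upstream_deg :: "nat set \<Rightarrow> nat set \<Rightarrow> param \<Rightarrow> int \<times> int" where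
  "upstream_deg H Ob (A i) = (if i \<in> H then (1, 0) else if i \<in> Ob then (1, 2) else (0, 0))"
| "upstream_deg H Ob (Lam i j) = (if i \<in> H \<and> j \<in> Ob then (0, 1) else (0, 0))"

text \<open>The degree assigned to the variable \<open>\<sigma>\<^sub>i\<^sub>j\<close>, also when its image vanishes. The last
  case is never reached for vertices of the graph.\<close>

fun sigma_deg :: "nat set \<Rightarrow> nat set \<Rightarrow> nat \<times> nat \<Rightarrow> int \<times> int" where
  "sigma_deg H Ob (i, j) =
     (if i \<in> H \<and> j \<in> H then (1, 0)
      else if i \<in> H \<and> j \<in> Ob \<or> i \<in> Ob \<and> j \<in> H then (1, 1)
      else if i \<in> Ob \<and> j \<in> Ob then (1, 2)
      else (0, 0))"


section \<open>Substitution is an algebra homomorphism\<close>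

definition mono_subst :: "('v \<Rightarrow> 'w cpoly) \<Rightarrow> ('v \<Rightarrow>\<^sub>0 nat) \<Rightarrow> 'w cpoly" where
  "mono_subst s m = (\<Prod>v \<in> Poly_Mapping.keys m. s v ^ Poly_Mapping.lookup m v)"

lemma mono_subst_superset:
  assumes "finite S" "Poly_Mapping.keys m \<subseteq> S"
  shows "mono_subst s m = (\<Prod>v\<in>S. s v ^ Poly_Mapping.lookup m v)"
  unfolding mono_subst_def
  by (rule prod.mono_neutral_left) (use assms in \<open>auto simp: in_keys_iff\<close>)

lemma mono_subst_add: "mono_subst s (m + m') = mono_subst s m * mono_subst s m'"
proof -
  let ?S = "Poly_Mapping.keys m \<union> Poly_Mapping.keys m'"
  have "mono_subst s (m + m') = (\<Prod>v\<in>?S. s v ^ Poly_Mapping.lookup (m + m') v)"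
    by (rule mono_subst_superset) (use keys_add[of m m'] in auto)
  also have "\<dots> = (\<Prod>v\<in>?S. s v ^ Poly_Mapping.lookup m v) * (\<Prod>v\<in>?S. s v ^ Poly_Mapping.lookup m' v)"
    by (simp add: lookup_add power_add prod.distrib)
  also have "\<dots> = mono_subst s m * mono_subst s m'"
    by (simp add: mono_subst_superset[of ?S])
  finally show ?thesis .
qed

lemma poly_subst_superset:
  assumes "finite S" "Poly_Mapping.keys f \<subseteq> S"
  shows "poly_subst s f = (\<Sum>m\<in>S. Const (Poly_Mapping.lookup f m) * mono_subst s m)"
  unfolding poly_subst_def mono_subst_def[symmetric]
  by (rule sum.mono_neutral_left) (use assms in \<open>auto simp: in_keys_iff Const_def\<close>)

lemma poly_subst_add: "poly_subst s (f + g) = poly_subst s f + poly_subst s g"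
proof -
  let ?S = "Poly_Mapping.keys f \<union> Poly_Mapping.keys g"
  have "poly_subst s (f + g) = (\<Sum>m\<in>?S. Const (Poly_Mapping.lookup (f + g) m) * mono_subst s m)"
    by (rule poly_subst_superset) (use keys_add[of f g] in auto)
  then show ?thesis
    by (simp add: poly_subst_superset[of ?S] lookup_add Const_def single_add
        distrib_right sum.distrib)
qed

lemma poly_subst_0 [simp]: "poly_subst s 0 = 0"
  by (simp add: poly_subst_def)

lemma poly_subst_sum: "poly_subst s (sum f S) = (\<Sum>x\<in>S. poly_subst s (f x))"
  by (induction S rule: infinite_finite_induct) (auto simp: poly_subst_add)

lemma poly_subst_single: "poly_subst s (Poly_Mapping.single m c) = Const c * mono_subst s m"
  by (cases "c = 0") (auto simp: poly_subst_def mono_subst_def Const_def)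

lemma poly_subst_Const: "poly_subst s (Const c) = Const c"
  unfolding Const_def poly_subst_single by (simp add: mono_subst_def Const_def)

lemma poly_subst_Var: "poly_subst s (Var v) = s v"
  unfolding Var_def poly_subst_single by (simp add: mono_subst_def Const_def)

lemma cpoly_sum_singles:
  "(\<Sum>m \<in> Poly_Mapping.keys f. Poly_Mapping.single m (Poly_Mapping.lookup f m)) = f"
proof (rule poly_mapping_eqI)
  fix k
  have "(\<Sum>m \<in> Poly_Mapping.keys f. if m = k then Poly_Mapping.lookup f m else 0) =
      Poly_Mapping.lookup f k"
    by (simp add: in_keys_iff)
  then show "Poly_Mapping.lookup (\<Sum>m \<in> Poly_Mapping.keys f.
      Poly_Mapping.single m (Poly_Mapping.lookup f m)) k = Poly_Mapping.lookup f k"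
    by (simp add: lookup_sum lookup_single when_def)
qed

lemma Const_mult: "Const (c * d) = Const c * Const d"
  by (simp add: Const_def mult_single)

lemma poly_subst_mult: "poly_subst s (f * g) = poly_subst s f * poly_subst s g"
proof -
  let ?f = "\<lambda>m. Poly_Mapping.single m (Poly_Mapping.lookup f m)"
  let ?g = "\<lambda>m. Poly_Mapping.single m (Poly_Mapping.lookup g m)"
  have single: "poly_subst s (?f m * ?g m') = poly_subst s (?f m) * poly_subst s (?g m')" for m m'
    by (simp add: mult_single poly_subst_single mono_subst_add Const_mult ac_simps)
  have "f * g = (\<Sum>m\<in>Poly_Mapping.keys f. \<Sum>m'\<in>Poly_Mapping.keys g. ?f m * ?g m')"
    by (simp only: sum_product[symmetric] cpoly_sum_singles)
  then have "poly_subst s (f * g) =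
      (\<Sum>m\<in>Poly_Mapping.keys f. \<Sum>m'\<in>Poly_Mapping.keys g. poly_subst s (?f m) * poly_subst s (?g m'))"
    by (simp only: poly_subst_sum single)
  also have "\<dots> = poly_subst s (sum ?f (Poly_Mapping.keys f)) * poly_subst s (sum ?g (Poly_Mapping.keys g))"
    by (simp only: sum_product[symmetric] poly_subst_sum)
  finally show ?thesis
    by (simp only: cpoly_sum_singles)
qed

end

theory Submission
  imports Defs "HOL-Library.Product_Plus"
begin

text \<open>Let \<open>g v\<close> be \<open>1\<close> for observed and \<open>0\<close> for hidden \<open>v\<close>. For an upstream partition every
  edge \<open>k \<rightarrow> l\<close> has \<open>deg \<lambda>\<^sub>k\<^sub>l = (0, g l - g k)\<close>, while \<open>deg a\<^sub>v = (1, 2 g v)\<close>. Along the two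
  descending halves of a trek from \<open>i\<close> to \<open>j\<close> the edge degrees telescope, so that each trek
  monomial has degree \<open>(1, g i + g j)\<close> whatever its top. Thus \<open>\<phi>\<^sub>G\<close> is a graded homomorphism,
  it commutes with taking homogeneous components, and its kernel is homogeneous.\<close>

section \<open>Graded polynomials\<close>

text \<open>Exponents vanish off the keys, so any finite larger index set gives the same sum. Taking
  one sum in the product group, rather than a pair of sums, gives the shape produced by products of
  homogeneous factors.\<close>

lemma mono_deg_superset:
  assumes "finite S" "Poly_Mapping.keys m \<subseteq> S"
  shows "mono_deg w m = (\<Sum>v\<in>S. (int (Poly_Mapping.lookup m v) * fst (w v),
           int (Poly_Mapping.lookup m v) * snd (w v)))"
  unfolding mono_deg_def
  by (intro prod_eqI; simp add: fst_sum snd_sum; rule sum.mono_neutral_left)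
     (use assms in \<open>auto simp: in_keys_iff\<close>)

lemma mono_deg_0 [simp]: "mono_deg w 0 = 0"
  by (simp add: mono_deg_def zero_prod_def)

lemma mono_deg_add: "mono_deg w (m + m') = mono_deg w m + mono_deg w m'"
proof -
  let ?S = "Poly_Mapping.keys m \<union> Poly_Mapping.keys m'"
  have "Poly_Mapping.keys (m + m') \<subseteq> ?S"
    by (rule keys_add)
  then show ?thesis
    by (simp add: mono_deg_superset[of ?S] lookup_add distrib_right flip: sum.distrib)
qed

lemma homogeneous_of_degree_0 [simp]: "homogeneous_of_degree w d 0"
  by (simp add: homogeneous_of_degree_def)

lemma homogeneous_of_degree_Const: "homogeneous_of_degree w 0 (Const c)"
  by (simp add: homogeneous_of_degree_def Const_def)

lemma homogeneous_of_degree_1: "homogeneous_of_degree w 0 1"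
  using homogeneous_of_degree_Const[of w 1] by (simp add: Const_def)

lemma homogeneous_of_degree_Var: "homogeneous_of_degree w (w v) (Var v)"
  by (simp add: homogeneous_of_degree_def Var_def mono_deg_def)

lemma homogeneous_of_degree_add:
  "homogeneous_of_degree w d f \<Longrightarrow> homogeneous_of_degree w d g \<Longrightarrow>
     homogeneous_of_degree w d (f + g)"
  using keys_add[of f g] by (auto simp: homogeneous_of_degree_def)

lemma homogeneous_of_degree_sum:
  "(\<And>x. x \<in> S \<Longrightarrow> homogeneous_of_degree w d (f x)) \<Longrightarrow> homogeneous_of_degree w d (sum f S)"
  by (induction S rule: infinite_finite_induct) (auto intro: homogeneous_of_degree_add)

lemma homogeneous_of_degree_mult:
  assumes "homogeneous_of_degree w d f" "homogeneous_of_degree w e g"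
  shows "homogeneous_of_degree w (d + e) (f * g)"
  unfolding homogeneous_of_degree_def
proof
  fix m assume "m \<in> Poly_Mapping.keys (f * g)"
  then obtain a b where "a \<in> Poly_Mapping.keys f" "b \<in> Poly_Mapping.keys g" "m = a + b"
    using keys_mult[of f g] by blast
  with assms show "mono_deg w m = d + e"
    by (simp add: homogeneous_of_degree_def mono_deg_add)
qed

lemma homogeneous_of_degree_prod:
  assumes "\<And>x. x \<in> S \<Longrightarrow> homogeneous_of_degree w (d x) (f x)"
  shows "homogeneous_of_degree w (\<Sum>x\<in>S. d x) (\<Prod>x\<in>S. f x)"
  using assms
  by (induction S rule: infinite_finite_induct)
     (auto intro: homogeneous_of_degree_mult homogeneous_of_degree_1)

lemma homogeneous_of_degree_power:
  assumes "homogeneous_of_degree w d f"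
  shows "homogeneous_of_degree w (int k * fst d, int k * snd d) (f ^ k)"
proof (induction k)
  case 0
  show ?case
    using homogeneous_of_degree_1[of w] by (simp add: zero_prod_def)
next
  case (Suc k)
  have "d + (int k * fst d, int k * snd d) = (int (Suc k) * fst d, int (Suc k) * snd d)"
    by (simp add: prod_eq_iff algebra_simps)
  with homogeneous_of_degree_mult[OF assms Suc] show ?case
    by simp
qed

text \<open>Any monomial of the nonzero \<open>f\<close> pins the degree down, so the definite
  description in \<open>hdeg\<close> has exactly one solution.\<close>

lemma hdeg_eq:
  assumes "homogeneous_of_degree w d f" "f \<noteq> 0"
  shows "hdeg w f = d"
  unfolding hdeg_def
proof (rule the_equality)
  fix e assume "homogeneous_of_degree w e f"
  moreover obtain m where "m \<in> Poly_Mapping.keys f"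
    using assms(2) by fastforce
  ultimately show "e = d"
    using assms(1) by (auto simp: homogeneous_of_degree_def)
qed (fact assms(1))

section \<open>Homogeneous components\<close>

lemma lookup_hcomponent:
  "Poly_Mapping.lookup (hcomponent w d f) m = (Poly_Mapping.lookup f m when mono_deg w m = d)"
proof -
  have "finite {m \<in> Poly_Mapping.keys f. mono_deg w m = d}"
    by simp
  then show ?thesis
    by (auto simp: hcomponent_def lookup_sum lookup_single when_def sum.delta in_keys_iff)
qed

lemma keys_hcomponent: "Poly_Mapping.keys (hcomponent w d f) \<subseteq> Poly_Mapping.keys f"
  by (auto simp: in_keys_iff lookup_hcomponent)

lemma hcomponent_0 [simp]: "hcomponent w d 0 = 0"
  by (simp add: hcomponent_def)

lemma hcomponent_add: "hcomponent w d (f + g) = hcomponent w d f + hcomponent w d g"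
  by (rule poly_mapping_eqI) (simp add: lookup_hcomponent lookup_add when_def)

lemma hcomponent_sum: "hcomponent w d (sum f S) = (\<Sum>x\<in>S. hcomponent w d (f x))"
  by (induction S rule: infinite_finite_induct) (auto simp: hcomponent_add)

lemma hcomponent_homogeneous:
  assumes "homogeneous_of_degree w e f"
  shows "hcomponent w d f = (if e = d then f else 0)"
proof (rule poly_mapping_eqI)
  fix m
  show "Poly_Mapping.lookup (hcomponent w d f) m = Poly_Mapping.lookup (if e = d then f else 0) m"
    using assms by (cases "m \<in> Poly_Mapping.keys f")
      (auto simp: lookup_hcomponent when_def homogeneous_of_degree_def in_keys_iff)
qed


section \<open>Kernels of graded substitutions\<close>

lemma homogeneous_of_degree_mono_subst:
  assumes "\<And>v. v \<in> Poly_Mapping.keys m \<Longrightarrow> homogeneous_of_degree w' (w v) (s v)"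
  shows "homogeneous_of_degree w' (mono_deg w m) (mono_subst s m)"
  unfolding mono_subst_def mono_deg_superset[OF finite_keys subset_refl]
  using assms by (intro homogeneous_of_degree_prod homogeneous_of_degree_power)

text \<open>Each term of \<open>f\<close> is sent to a homogeneous polynomial of the same degree, so
  selecting terms before or after substitution gives the same result. Only variables in
  \<open>V\<close> can occur in \<open>f\<close>, hence \<open>s\<close> has to respect degrees only
  there.\<close>

lemma hcomponent_poly_subst:
  assumes s: "\<And>v. v \<in> V \<Longrightarrow> homogeneous_of_degree w' (w v) (s v)"
    and f: "f \<in> poly_over V"
  shows "hcomponent w' d (poly_subst s f) = poly_subst s (hcomponent w d f)"
proof -
  let ?c = "\<lambda>m. Poly_Mapping.single m (Poly_Mapping.lookup f m)"
  have hom: "homogeneous_of_degree w' (mono_deg w m) (poly_subst s (?c m))"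
    if "m \<in> Poly_Mapping.keys f" for m
  proof -
    have "homogeneous_of_degree w' (mono_deg w m) (mono_subst s m)"
      using that f by (intro homogeneous_of_degree_mono_subst s) (auto simp: poly_over_def)
    from homogeneous_of_degree_mult[OF homogeneous_of_degree_Const this] show ?thesis
      by (simp add: poly_subst_single)
  qed
  have "hcomponent w' d (poly_subst s f) =
      hcomponent w' d (poly_subst s (\<Sum>m\<in>Poly_Mapping.keys f. ?c m))"
    by (simp only: cpoly_sum_singles)
  also have "\<dots> = (\<Sum>m\<in>Poly_Mapping.keys f. hcomponent w' d (poly_subst s (?c m)))"
    by (simp only: poly_subst_sum hcomponent_sum)
  \<comment> \<open>The image of each term is homogeneous, so its component of degree
    \<open>d\<close> is either the whole image or zero.\<close>
  also have "\<dots> = (\<Sum>m\<in>Poly_Mapping.keys f. if mono_deg w m = d then poly_subst s (?c m) else 0)"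
    by (intro sum.cong refl hcomponent_homogeneous hom)
  also have "\<dots> = (\<Sum>m\<in>{m \<in> Poly_Mapping.keys f. mono_deg w m = d}. poly_subst s (?c m))"
    by (simp add: sum.inter_filter)
  also have "\<dots> = poly_subst s (hcomponent w d f)"
    by (simp only: hcomponent_def poly_subst_sum)
  finally show ?thesis .
qed

section \<open>Kernels as ideals of the polynomials over \<open>V\<close>\<close>

lemma poly_over_add: "f \<in> poly_over V \<Longrightarrow> g \<in> poly_over V \<Longrightarrow> f + g \<in> poly_over V"
  using keys_add[of f g] by (auto simp: poly_over_def)

lemma poly_over_mult:
  assumes "f \<in> poly_over V" "g \<in> poly_over V"
  shows "f * g \<in> poly_over V"
  unfolding poly_over_def
proof safe
  fix m v assume "m \<in> Poly_Mapping.keys (f * g)" and v: "v \<in> Poly_Mapping.keys m"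
  then obtain a b where "a \<in> Poly_Mapping.keys f" "b \<in> Poly_Mapping.keys g" "m = a + b"
    using keys_mult[of f g] by blast
  moreover from this v have "v \<in> Poly_Mapping.keys a \<union> Poly_Mapping.keys b"
    using keys_add[of a b] by blast
  ultimately show "v \<in> V"
    using assms by (auto simp: poly_over_def)
qed

lemma poly_ideal_kernel: "poly_ideal V {f \<in> poly_over V. poly_subst s f = 0}"
  by (auto simp: poly_ideal_def poly_subst_add poly_subst_mult poly_over_add poly_over_mult)
     (simp add: poly_over_def)

text \<open>A component of \<open>f\<close> is sent to the corresponding component of the image of
  \<open>f\<close>, which is a component of zero.\<close>

lemma homogeneous_ideal_kernel:
  assumes "\<And>v. v \<in> V \<Longrightarrow> homogeneous_of_degree w' (w v) (s v)"
  shows "homogeneous_ideal V w {f \<in> poly_over V. poly_subst s f = 0}"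
  unfolding homogeneous_ideal_def
proof (intro conjI poly_ideal_kernel ballI allI)
  fix f d assume "f \<in> {f \<in> poly_over V. poly_subst s f = 0}"
  then have f: "f \<in> poly_over V" and "poly_subst s f = 0"
    by auto
  then have "poly_subst s (hcomponent w d f) = 0"
    by (simp flip: hcomponent_poly_subst[OF assms f])
  moreover have "hcomponent w d f \<in> poly_over V"
    using f keys_hcomponent[of w d f] by (auto simp: poly_over_def)
  ultimately show "hcomponent w d f \<in> {f \<in> poly_over V. poly_subst s f = 0}"
    by simp
qed


section \<open>The shape of a trek\<close>

text \<open>The edge at step \<open>m\<close> of a trek whose top has index \<open>t\<close>: the
  list climbs against the arrows before \<open>t\<close> and follows them afterwards. Indexing edges
  by steps turns sums over edges into sums over an initial segment of the naturals.\<close>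

definition trek_edge :: "nat list \<Rightarrow> nat \<Rightarrow> nat \<Rightarrow> nat \<times> nat" where
  "trek_edge p t m = (if m < t then (p ! Suc m, p ! m) else (p ! m, p ! Suc m))"

text \<open>A descent followed by an ascent would create a collider, so after the first descending
  step every step descends. The top is where that step starts.\<close>

lemma trek_turning_point:
  assumes p: "p \<in> treks n E i j"
  obtains t where "t < length p" "\<And>m. Suc m < length p \<Longrightarrow> trek_edge p t m \<in> E"
proof -
  have ne: "p \<noteq> []" and dist: "distinct p"
    and adj: "\<And>m. Suc m < length p \<Longrightarrow> (p ! m, p ! Suc m) \<in> E \<or> (p ! Suc m, p ! m) \<in> E"
    and nocol: "\<not> has_collider (path_edges E p)"
    using p by (auto simp: treks_def simple_path_def)
  define P where "P m \<longleftrightarrow> Suc m = length p \<or> (p ! m, p ! Suc m) \<in> E" for m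
  define t where "t = (LEAST m. P m)"
  have last: "P (length p - 1)"
    using ne by (simp add: P_def)
  have "P t"
    unfolding t_def using last by (rule LeastI)
  have tlen: "t < length p"
    unfolding t_def using Least_le[of P, OF last] ne
    by (metis One_nat_def diff_less le_less_trans length_greater_0_conv zero_less_one)
  have up: "(p ! Suc m, p ! m) \<in> E" if "m < t" for m
    using not_less_Least[of m P] that adj[of m] tlen by (auto simp: t_def P_def)
  have down: "(p ! m, p ! Suc m) \<in> E" if "t \<le> m" "Suc m < length p" for m
    using that
  proof (induction m rule: dec_induct)
    case base
    with \<open>P t\<close> show ?case
      by (auto simp: P_def)
  next
    case (step m)
    show ?case
    proof (rule ccontr)
      \<comment> \<open>If the next step ascended, both neighbours of \<open>p ! Suc m\<close> would
        point to it; they differ because \<open>p\<close> is distinct.\<close>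
      assume "\<not> ?case"
      with adj step.prems have "(p ! Suc (Suc m), p ! Suc m) \<in> path_edges E p"
        by (auto simp: path_edges_def intro!: exI[of _ "Suc m"])
      moreover have "(p ! m, p ! Suc m) \<in> path_edges E p"
        using step by (auto simp: path_edges_def intro!: exI[of _ m])
      moreover have "p ! m \<noteq> p ! Suc (Suc m)"
        using dist step.prems by (simp add: nth_eq_iff_index_eq)
      ultimately show False
        using nocol by (auto simp: has_collider_def)
    qed
  qed
  show thesis
    by (rule that[OF tlen]) (auto simp: trek_edge_def up down)
qed

text \<open>\<open>path_edges\<close> collects every edge of \<open>E\<close> between consecutive
  vertices; asymmetry ensures that only one orientation of each step is collected.\<close>

lemma path_edges_trek:
  assumes edge: "\<And>m. Suc m < length p \<Longrightarrow> trek_edge p t m \<in> E"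
    and asym: "asym E"
  shows "path_edges E p = trek_edge p t ` {..<length p - 1}"
proof (intro equalityI subsetI)
  fix e assume "e \<in> path_edges E p"
  then obtain k l m where e: "e = (k, l)" "(k, l) \<in> E" and m: "Suc m < length p"
    and "{p ! m, p ! Suc m} = {k, l}"
    by (auto simp: path_edges_def)
  with edge[OF m] asymD[OF asym] have "e = trek_edge p t m"
    by (auto simp: trek_edge_def doubleton_eq_iff split: if_splits)
  with m show "e \<in> trek_edge p t ` {..<length p - 1}"
    by auto
next
  fix e assume "e \<in> trek_edge p t ` {..<length p - 1}"
  then obtain m where "m < length p - 1" and e: "e = trek_edge p t m"
    by blast
  then have m: "Suc m < length p"
    by simp
  from edge[OF m] m show "e \<in> path_edges E p"
    unfolding e by (auto simp: path_edges_def trek_edge_def insert_commute split: if_splits)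
qed

text \<open>The head of the edge has index \<open>m\<close> below \<open>t\<close> when climbing and
  \<open>Suc m\<close> above \<open>t\<close> when descending, so it determines the step. Thus no
  edge is counted twice when sums over the set of edges are reindexed.\<close>

lemma inj_on_trek_edge:
  assumes "distinct p"
  shows "inj_on (trek_edge p t) {..<length p - 1}"
  by (rule inj_onI)
     (use assms in \<open>auto simp: trek_edge_def nth_eq_iff_index_eq split: if_splits\<close>)

text \<open>Step \<open>m\<close> enters \<open>p ! m\<close> if \<open>m < t\<close>, and step
  \<open>m - 1\<close> enters it if \<open>t < m\<close>. Every vertex except \<open>p ! t\<close>
  is therefore entered by some edge.\<close>

lemma trek_top_eq:
  assumes dist: "distinct p" and t: "t < length p"
    and edges: "path_edges E p = trek_edge p t ` {..<length p - 1}"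
  shows "trek_top E p = p ! t"
  unfolding trek_top_def
proof (rule the_equality)
  show "p ! t \<in> set p \<and> (\<forall>u. (u, p ! t) \<notin> path_edges E p)"
    using dist t
    by (auto simp: edges trek_edge_def nth_eq_iff_index_eq split: if_splits)
next
  fix v assume v: "v \<in> set p \<and> (\<forall>u. (u, v) \<notin> path_edges E p)"
  then obtain m where m: "m < length p" "v = p ! m"
    by (auto simp: in_set_conv_nth)
  have "\<not> m < t"
  proof
    assume "m < t"
    then have "(p ! Suc m, v) \<in> path_edges E p"
      using m t unfolding edges by (intro image_eqI[of _ _ m]) (auto simp: trek_edge_def)
    with v show False
      by blast
  qed
  moreover have "\<not> t < m"
  proof
    assume "t < m"
    then have "(p ! (m - 1), v) \<in> path_edges E p"
      using m unfolding edges by (intro image_eqI[of _ _ "m - 1"]) (auto simp: trek_edge_def)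
    with v show False
      by blast
  qed
  ultimately show "v = p ! t"
    using m by simp
qed

text \<open>Both halves descend from \<open>p ! t\<close>, so each telescopes to an end value minus
  the value at the top. The induction starts at \<open>t\<close>: its base case is the climbing
  half, and each later step adds one descending edge.\<close>

lemma sum_trek_edges_telescope:
  fixes g :: "nat \<Rightarrow> int"
  assumes "t \<le> N"
  shows "(\<Sum>m<N. case trek_edge p t m of (k, l) \<Rightarrow> g l - g k) =
           g (p ! 0) + g (p ! N) - 2 * g (p ! t)"
  using assms
proof (induction N rule: dec_induct)
  case base
  have "(\<Sum>m<t. case trek_edge p t m of (k, l) \<Rightarrow> g l - g k) =
      (\<Sum>m<t. g (p ! m) - g (p ! Suc m))"
    by (rule sum.cong) (auto simp: trek_edge_def)
  also have "\<dots> = g (p ! 0) - g (p ! t)"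
    by (rule sum_lessThan_telescope')
  finally show ?case
    by simp
qed (simp add: trek_edge_def)

text \<open>The index \<open>t\<close> is eliminated in favour of \<open>trek_top\<close>. The first
  claim places the top among the vertices of the graph; the term
  \<open>- 2 * g (trek_top E p)\<close> in the second cancels the degree of its variable
  \<open>A\<close>.\<close>

lemma sum_path_edges_trek:
  fixes g :: "nat \<Rightarrow> int"
  assumes p: "p \<in> treks n E i j" and asym: "asym E"
  shows "trek_top E p \<in> set p"
    and "(\<Sum>(k, l)\<in>path_edges E p. g l - g k) = g i + g j - 2 * g (trek_top E p)"
proof -
  have ne: "p \<noteq> []" and ends: "hd p = i" "last p = j" and dist: "distinct p"
    using p by (auto simp: treks_def simple_path_def)
  obtain t where t: "t < length p" and edge: "\<And>m. Suc m < length p \<Longrightarrow> trek_edge p t m \<in> E"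
    using trek_turning_point[OF p] by blast
  have edges: "path_edges E p = trek_edge p t ` {..<length p - 1}"
    using edge asym by (rule path_edges_trek)
  have top: "trek_top E p = p ! t"
    by (rule trek_top_eq[OF dist t edges])
  then show "trek_top E p \<in> set p"
    using t by simp
  have "(\<Sum>(k, l)\<in>path_edges E p. g l - g k) =
      (\<Sum>m<length p - 1. case trek_edge p t m of (k, l) \<Rightarrow> g l - g k)"
    unfolding edges sum.reindex[OF inj_on_trek_edge[OF dist]] by (simp only: comp_def)
  also have "\<dots> = g (p ! 0) + g (p ! (length p - 1)) - 2 * g (p ! t)"
    using t by (intro sum_trek_edges_telescope) simp
  finally show "(\<Sum>(k, l)\<in>path_edges E p. g l - g k) = g i + g j - 2 * g (trek_top E p)"
    using ne ends top by (simp add: hd_conv_nth last_conv_nth)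
qed


section \<open>The upstream grading\<close>

lemma homogeneous_trek_sum:
  assumes dag: "ordered_dag n E" and up: "upstream_partition n E H Ob"
    and i: "i \<in> {1..n}" and j: "j \<in> {1..n}"
  shows "homogeneous_of_degree (upstream_deg H Ob) (sigma_deg H Ob (i, j)) (trek_sum n E i j)"
  unfolding trek_sum_def
proof (rule homogeneous_of_degree_sum)
  let ?w = "upstream_deg H Ob"
  define g :: "nat \<Rightarrow> int" where "g v = (if v \<in> Ob then 1 else 0)" for v
  have part: "H \<union> Ob = {1..n}" "H \<inter> Ob = {}" and noedge: "\<And>u h. u \<in> Ob \<Longrightarrow> h \<in> H \<Longrightarrow> (u, h) \<notin> E"
    using up by (auto simp: upstream_partition_def)
  have H_iff: "v \<in> H \<longleftrightarrow> v \<notin> Ob" if "v \<in> {1..n}" for v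
    using that part by blast
  have E: "k \<in> {1..n}" "l \<in> {1..n}" "k < l" if "(k, l) \<in> E" for k l
    using that dag by (auto simp: ordered_dag_def)
  have asym: "asym E"
    using E(3) by (meson asymI less_asym)
  have deg_A: "?w (A v) = (1, 2 * g v)" if "v \<in> {1..n}" for v
    using H_iff[OF that] by (auto simp: g_def)
  \<comment> \<open>The upstream condition excludes edges from \<open>Ob\<close> to
    \<open>H\<close>, the one case where \<open>g l - g k\<close> would be -1 although the variable
    has degree zero.\<close>
  have deg_Lam: "?w (Lam k l) = (0, g l - g k)" if "(k, l) \<in> E" for k l
    using noedge[of k l] H_iff[OF E(1)[OF that]] H_iff[OF E(2)[OF that]] that
    by (auto simp: g_def)
  fix p assume p: "p \<in> treks n E i j"
  have "set p \<subseteq> {1..n}"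
    using p by (auto simp: treks_def simple_path_def)
  with sum_path_edges_trek(1)[OF p asym] have top: "?w (A (trek_top E p)) = (1, 2 * g (trek_top E p))"
    by (intro deg_A) blast
  have "(\<Sum>(k, l)\<in>path_edges E p. ?w (Lam k l)) = (\<Sum>(k, l)\<in>path_edges E p. (0, g l - g k))"
    by (rule sum.cong) (auto simp: path_edges_def deg_Lam simp del: upstream_deg.simps)
  also have "\<dots> = (0, \<Sum>(k, l)\<in>path_edges E p. g l - g k)"
    by (simp add: prod_eq_iff fst_sum snd_sum case_prod_unfold)
  also have "\<dots> = (0, g i + g j - 2 * g (trek_top E p))"
    by (simp only: sum_path_edges_trek(2)[OF p asym])
  finally have "?w (A (trek_top E p)) + (\<Sum>(k, l)\<in>path_edges E p. ?w (Lam k l)) = (1, g i + g j)"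
    unfolding top by simp
  \<comment> \<open>The values 0, 1, 2 of \<open>g i + g j\<close> match the three cases of
    \<open>sigma_deg\<close>; its default case cannot occur since \<open>i\<close> and
    \<open>j\<close> are vertices.\<close>
  also have "\<dots> = sigma_deg H Ob (i, j)"
    using H_iff[OF i] H_iff[OF j] by (auto simp: g_def)
  finally have deg: "sigma_deg H Ob (i, j) =
      ?w (A (trek_top E p)) + (\<Sum>(k, l)\<in>path_edges E p. ?w (Lam k l))" ..
  show "homogeneous_of_degree ?w (sigma_deg H Ob (i, j))
      (Var (A (trek_top E p)) * (\<Prod>(k, l)\<in>path_edges E p. Var (Lam k l)))"
    unfolding deg case_prod_unfold
    by (intro homogeneous_of_degree_mult homogeneous_of_degree_prod homogeneous_of_degree_Var)
qed

text \<open>Needed because \<open>sigma\<close> sorts its two indices, whereas the degree formula is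
  claimed for either order.\<close>

lemma sigma_deg_commute: "sigma_deg H Ob (i, j) = sigma_deg H Ob (j, i)"
  by (simp add: conj_commute disj_commute)

theorem lemma6p3:
  fixes n :: nat and E :: "(nat \<times> nat) set" and H Ob :: "nat set"
  assumes "ordered_dag n E"
    and "upstream_partition n E H Ob"
  shows "(\<forall>i \<in> {1..n}. \<forall>j \<in> {1..n}.
            homogeneous (upstream_deg H Ob) (phi n E (sigma i j)) \<and>
            (phi n E (sigma i j) \<noteq> 0 \<longrightarrow>
               hdeg (upstream_deg H Ob) (phi n E (sigma i j)) = sigma_deg H Ob (i, j))) \<and>
         homogeneous_ideal (sigma_vars n) (sigma_deg H Ob) (I_G n E)"
proof (intro conjI ballI)
  have hom: "homogeneous_of_degree (upstream_deg H Ob) (sigma_deg H Ob (i, j)) (phi n E (sigma i j))"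
    if "i \<in> {1..n}" "j \<in> {1..n}" for i j
  proof -
    have "sigma_deg H Ob (min i j, max i j) = sigma_deg H Ob (i, j)"
      using sigma_deg_commute[of H Ob i j]
      by (cases "i \<le> j")
         (simp_all only: min_absorb1 min_absorb2 max_absorb1 max_absorb2 nat_le_linear)
    moreover have "phi n E (sigma i j) = trek_sum n E (min i j) (max i j)"
      by (simp add: phi_def sigma_def poly_subst_Var)
    moreover have "min i j \<in> {1..n}" "max i j \<in> {1..n}"
      using that by auto
    ultimately show ?thesis
      using homogeneous_trek_sum[OF assms] by metis
  qed
  fix i j assume ij: "i \<in> {1..n}" "j \<in> {1..n}"
  show "homogeneous (upstream_deg H Ob) (phi n E (sigma i j))"
    using hom[OF ij] unfolding homogeneous_def by blast
  show "phi n E (sigma i j) \<noteq> 0 \<longrightarrow>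
      hdeg (upstream_deg H Ob) (phi n E (sigma i j)) = sigma_deg H Ob (i, j)"
    using hdeg_eq[OF hom[OF ij]] by blast
next
  show "homogeneous_ideal (sigma_vars n) (sigma_deg H Ob) (I_G n E)"
    unfolding I_G_def phi_def
  proof (rule homogeneous_ideal_kernel)
    \<comment> \<open>Variables with zero image are covered as well: zero is homogeneous of whatever
      degree \<open>sigma_deg\<close> assigns.\<close>
    fix v assume "v \<in> sigma_vars n"
    then obtain i j where "v = (i, j)" "i \<in> {1..n}" "j \<in> {1..n}"
      by (auto simp: sigma_vars_def)
    with homogeneous_trek_sum[OF assms, of i j]
    show "homogeneous_of_degree (upstream_deg H Ob) (sigma_deg H Ob v)
        (case v of (i, j) \<Rightarrow> trek_sum n E i j)"
      by (simp only: case_prod_conv)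
  qed
qed

end
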